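(* For a threshold $\tau\in\mathbb R$ let $\dot H_\tau(x)=x\cdot1_{\{x\ge\tau\}}$. (a) (Case $\gamma_n\to0$.) For each $\star\in\{F,O,N\}$ there is a unique admissible normalized threshold $\tilde\tau_\star$ for the asymptotic loss $\tilde{\mathcal L}_\star$: for any other threshold $\nu\ne\tilde\tau_\star$, $$\tilde{\mathcal L}_\star\big(\ell,\dot H_{\tilde\tau_\star}(\tilde\lambda(\ell))\big)\le\tilde{\mathcal L}_\star\big(\ell,\dot H_{\nu}(\tilde\lambda(\ell))\big)\quad\text{for all }\ell\ge0,$$ with strict inequality at some $\ell\ge0$. The values are $\tilde\tau_F=4/\sqrt3$, $\tilde\tau_O=\sqrt{2(1+\sqrt2)}$, $\tilde\tau_N=6/\sqrt5$. (b) (Case $\gamma_n\to\infty$.) For each $\star\in\{F,O,N\}$ there is a unique admissible normalized threshold $\bar\tau_\star$ for the asymptotic loss $\mathcal L_\star$: for any other threshold $\nu\ne\bar\tau_\star$, $$\mathcal L_\star\big(\rho,\dot H_{\bar\tau_\star}(1+\rho)\big)\le\mathcal L_\star\big(\rho,\dot H_{\nu}(1+\rho)\big)\quad\text{for all }\rho\ge0,$$ with strict inequality at some $\rho\ge0$. The values are $\bar\tau_F=2+\sqrt2$, $\bar\tau_O=3$, $\bar\tau_N=3+\sqrt5$.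
   Context: $\|\cdot\|_F,\|\cdot\|_O,\|\cdot\|_N$ are the Frobenius, operator and nuclear norms. For $\ell\ge0$, $\vartheta\in\mathbb R$ and $c\in[0,1]$, $s=\sqrt{1-c^2}$, write $M(\ell,\vartheta,c)=\begin{bmatrix}\ell-\vartheta c^2&-\vartheta cs\\-\vartheta cs&-\vartheta s^2\end{bmatrix}$. Case $\gamma_n=p/n\to0$: $\tilde{\mathcal L}_\star(\ell,\vartheta)=\|M(\ell,\vartheta,\tilde c(\ell))\|_\star$ with $\tilde c(\ell)=\sqrt{1-1/\ell^2}$ for $\ell>1$ and $\tilde c(\ell)=0$ for $\ell\le1$; the limiting normalized empirical eigenvalue is $\tilde\lambda(\ell)=\ell+1/\ell$ for $\ell>1$ and $\tilde\lambda(\ell)=2$ for $0\le\ell\le1$. Here $\ell$ is the normalized spike, the spiked covariance eigenvalue being $1+\ell\sqrt{\gamma_n}(1+o(1))$, and normalized empirical eigenvalues are $(\lambda-1-\gamma_n)/\sqrt{\gamma_n}$. Case $\gamma_n\to\infty$: $\mathcal L_\star(\rho,\vartheta)=\|M(\rho,\vartheta,c(\rho))\|_\star$ with $c(\rho)=\sqrt{\rho/(1+\rho)}$; the limiting normalized empirical eigenvalue is $1+\rho$. Here the spiked covariance eigenvalue is $1+(\rho+o(1))\gamma_n$, and normalized empirical eigenvalues are $(\lambda-1)/\gamma_n$. These functions are the asymptotic (rescaled) losses of rank-one shrinkage estimators whose normalized shrunken eigenvalue converges to $\vartheta$; the asymptotic loss of the hard-thresholding rule with normalized threshold $\tau$ is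 taken to be the loss at $\vartheta=\dot H_\tau$ of the limiting normalized empirical eigenvalue. *)

theory Defs
  imports "HOL-Analysis.Analysis" "HOL-Computational_Algebra.Polynomial"
begin

definition frobenius_norm :: "real ^ 'n ^ 'm \<Rightarrow> real" where
  "frobenius_norm A = sqrt (\<Sum>i\<in>UNIV. \<Sum>j\<in>UNIV. (A $ i $ j)\<^sup>2)"

definition operator_norm :: "real ^ 'n ^ 'm \<Rightarrow> real" where
  "operator_norm A = onorm (\<lambda>x. A *v x)"

definition charpoly :: "real ^ 'n ^ 'n \<Rightarrow> real poly" where
  "charpoly A = det (\<chi> i j. if i = j then [:- (A $ i $ j), 1:] else [:- (A $ i $ j):])"

(* proots lists the real roots with multiplicity; the Gram matrix is symmetric,
   so these are all of its eigenvalues. *)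
definition singular_values :: "real ^ 'n ^ 'm \<Rightarrow> real multiset" where
  "singular_values A = image_mset sqrt (proots (charpoly (transpose A ** A)))"

definition nuclear_norm :: "real ^ 'n ^ 'm \<Rightarrow> real" where
  "nuclear_norm A = sum_mset (singular_values A)"

definition loss_matrix :: "real \<Rightarrow> real \<Rightarrow> real \<Rightarrow> real ^ 2 ^ 2" where
  "loss_matrix l \<theta> c = (let s = sqrt (1 - c\<^sup>2) in
     vector [vector [l - \<theta> * c\<^sup>2, - \<theta> * c * s],
             vector [- \<theta> * c * s, - \<theta> * s\<^sup>2]])"

(* The suffixes _zero and _infty refer to p/n tending to 0 and to infinity.
   The argument N of the losses is the matrix norm. *)
definition c_zero :: "real \<Rightarrow> real" where
  "c_zero l = (if l > 1 then sqrt (1 - 1 / l\<^sup>2) else 0)"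

definition lambda_zero :: "real \<Rightarrow> real" where
  "lambda_zero l = (if l > 1 then l + 1 / l else 2)"

definition loss_zero :: "(real ^ 2 ^ 2 \<Rightarrow> real) \<Rightarrow> real \<Rightarrow> real \<Rightarrow> real" where
  "loss_zero N l \<theta> = N (loss_matrix l \<theta> (c_zero l))"

definition c_infty :: "real \<Rightarrow> real" where
  "c_infty \<rho> = sqrt (\<rho> / (1 + \<rho>))"

definition lambda_infty :: "real \<Rightarrow> real" where
  "lambda_infty \<rho> = 1 + \<rho>"

definition loss_infty :: "(real ^ 2 ^ 2 \<Rightarrow> real) \<Rightarrow> real \<Rightarrow> real \<Rightarrow> real" where
  "loss_infty N \<rho> \<theta> = N (loss_matrix \<rho> \<theta> (c_infty \<rho>))"

definition hard_threshold :: "real \<Rightarrow> real \<Rightarrow> real" where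
  "hard_threshold \<tau> x = (if x \<ge> \<tau> then x else 0)"

(* L l \<theta> is the asymptotic loss at spike l of a shrunken eigenvalue \<theta>,
   lam l the limiting normalized empirical eigenvalue. *)
definition threshold_loss ::
  "(real \<Rightarrow> real \<Rightarrow> real) \<Rightarrow> (real \<Rightarrow> real) \<Rightarrow> real \<Rightarrow> real \<Rightarrow> real" where
  "threshold_loss L lam \<tau> l = L l (hard_threshold \<tau> (lam l))"

definition dominates ::
  "(real \<Rightarrow> real \<Rightarrow> real) \<Rightarrow> (real \<Rightarrow> real) \<Rightarrow> real \<Rightarrow> real \<Rightarrow> bool" where
  "dominates L lam \<tau> \<nu> \<longleftrightarrow>
     (\<forall>l\<ge>0. threshold_loss L lam \<tau> l \<le> threshold_loss L lam \<nu> l) \<and>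
     (\<exists>l\<ge>0. threshold_loss L lam \<tau> l < threshold_loss L lam \<nu> l)"

definition admissible_threshold ::
  "(real \<Rightarrow> real \<Rightarrow> real) \<Rightarrow> (real \<Rightarrow> real) \<Rightarrow> real \<Rightarrow> bool" where
  "admissible_threshold L lam \<tau> \<longleftrightarrow> \<not> (\<exists>\<nu>. dominates L lam \<nu> \<tau>)"

(* The second conjunct implies the first, since domination is asymmetric. *)
definition unique_admissible ::
  "(real \<Rightarrow> real \<Rightarrow> real) \<Rightarrow> (real \<Rightarrow> real) \<Rightarrow> real \<Rightarrow> bool" where
  "unique_admissible L lam \<tau> \<longleftrightarrow>
     (\<forall>\<nu>. admissible_threshold L lam \<nu> \<longleftrightarrow> \<nu> = \<tau>) \<and>
     (\<forall>\<nu>. \<nu> \<noteq> \<tau> \<longrightarrow> dominates L lam \<tau> \<nu>)"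

end

theory Submission
  imports Defs
begin

text \<open>
  The loss matrix is symmetric with trace \<open>l - \<theta>\<close> and determinant \<open>- l \<theta> s\<^sup>2 \<le> 0\<close>, and the three
  norms of such a matrix are explicit functions of trace and determinant. At \<open>\<theta> = 0\<close> each loss
  equals the spike \<open>l\<close>, while at \<open>\<theta> = \<lambda>(l)\<close> it is \<open>< l\<close> exactly when the empirical eigenvalue
  exceeds the critical value \<open>\<tau>\<close>. The threshold \<open>\<tau>\<close> thus picks the smaller of the two losses at
  every spike, and any other threshold picks the larger one somewhere.
\<close>

section \<open>Norms of symmetric two by two matrices\<close>

text \<open>For symmetric \<open>A\<close> the sum of the squared entries is the trace of A^2, that
  is t^2 - 2 det A.\<close>

lemma frobenius_norm_sym2:
  fixes A :: "real^2^2"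
  assumes sym: "A $ 2 $ 1 = A $ 1 $ 2" and tr: "A$1$1 + A$2$2 = t"
    and det: "A$1$1 * A$2$2 - (A$1$2)\<^sup>2 = - q"
  shows "frobenius_norm A = sqrt (t\<^sup>2 + 2 * q)"
proof -
  have "(A$1$1)\<^sup>2 + (A$1$2)\<^sup>2 + ((A$1$2)\<^sup>2 + (A$2$2)\<^sup>2) = t\<^sup>2 + 2 * q"
    using det unfolding tr[symmetric] by (simp add: power2_eq_square algebra_simps)
  then show ?thesis
    by (simp add: frobenius_norm_def sum_2 sym)
qed

text \<open>The Gram matrix is A^2, so its eigenvalues are the squares of those of \<open>A\<close>.
  Giving \<open>x\<close> and \<open>y\<close> by their sum and product avoids any diagonalization:
  only the trace and the determinant of the Gram matrix have to be matched, in facts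
  \<open>1\<close> and \<open>2\<close>.\<close>

lemma charpoly_Gram_sym2:
  fixes A :: "real^2^2"
  assumes sym: "A $ 2 $ 1 = A $ 1 $ 2" and tr: "A$1$1 + A$2$2 = x + y"
    and det: "A$1$1 * A$2$2 - (A$1$2)\<^sup>2 = x * y"
  shows "charpoly (transpose A ** A) = [:- x\<^sup>2, 1:] * [:- y\<^sup>2, 1:]"
proof -
  define a b d where "a = A$1$1" and "b = A$1$2" and "d = A$2$2"
  have xy: "x + y = a + d" "x * y = a * d - b\<^sup>2"
    using tr det by (simp_all add: a_def b_def d_def)
  have "x\<^sup>2 + y\<^sup>2 = (x + y)\<^sup>2 - 2 * (x * y)"
    by (simp add: power2_eq_square algebra_simps)
  then have 1: "x\<^sup>2 + y\<^sup>2 = a\<^sup>2 + d\<^sup>2 + 2 * b\<^sup>2"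
    unfolding xy by (simp add: power2_eq_square algebra_simps)
  have "x\<^sup>2 * y\<^sup>2 = (x * y)\<^sup>2"
    by (simp add: power_mult_distrib)
  then have 2: "x\<^sup>2 * y\<^sup>2 = (a\<^sup>2 + b\<^sup>2) * (b\<^sup>2 + d\<^sup>2) - (a * b + b * d)\<^sup>2"
    unfolding xy by (simp add: power2_eq_square algebra_simps)
  show ?thesis
    using 1 2
    by (simp add: charpoly_def det_2 matrix_matrix_mult_def transpose_def sum_2 sym
        a_def b_def d_def power2_eq_square algebra_simps)
qed

text \<open>A nonpositive determinant separates the eigenvalues, x >= 0 >= y, so the sum of singular
  values |x| + |y| is x - y, the square root of the discriminant of z^2 - t z - q.\<close>

lemma nuclear_norm_sym2:
  fixes A :: "real^2^2"
  assumes sym: "A $ 2 $ 1 = A $ 1 $ 2" and tr: "A$1$1 + A$2$2 = t"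
    and det: "A$1$1 * A$2$2 - (A$1$2)\<^sup>2 = - q" and q: "q \<ge> 0"
  shows "nuclear_norm A = sqrt (t\<^sup>2 + 4 * q)"
proof -
  define R where "R = sqrt (t\<^sup>2 + 4 * q)"
  define x y where "x = (t + R) / 2" and "y = (t - R) / 2"
  have R2: "R\<^sup>2 = t\<^sup>2 + 4 * q"
    using q by (simp add: R_def)
  have tR: "\<bar>t\<bar> \<le> R"
    using real_sqrt_le_mono[of "t\<^sup>2" "t\<^sup>2 + 4 * q"] q by (simp add: R_def)
  have "x * y = (t\<^sup>2 - R\<^sup>2) / 4"
    by (simp add: x_def y_def power2_eq_square algebra_simps)
  then have xy: "x * y = - q"
    by (simp add: R2)
  have xy': "x + y = t"
    by (simp add: x_def y_def field_simps)
  have "charpoly (transpose A ** A) = [:- x\<^sup>2, 1:] * [:- y\<^sup>2, 1:]"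
    using charpoly_Gram_sym2[OF sym] tr det xy xy' by simp
  then have "proots (charpoly (transpose A ** A)) = {#x\<^sup>2, y\<^sup>2#}"
    by (simp add: proots_mult del: mult_pCons_left mult_pCons_right)
  then have "nuclear_norm A = \<bar>x\<bar> + \<bar>y\<bar>"
    by (simp add: nuclear_norm_def singular_values_def)
  also have "\<dots> = R"
    using tR by (simp add: x_def y_def field_simps)
  finally show ?thesis
    by (simp add: R_def)
qed

text \<open>A symmetric matrix of order two with nonnegative trace and determinant is positive
  semidefinite: complete the square if \<open>p\<close> is positive; otherwise \<open>p\<close> and
  \<open>q\<close> vanish.\<close>

lemma binary_quadratic_form_nonneg:
  fixes p q r x y :: real
  assumes "p + r \<ge> 0" and disc: "p * r - q\<^sup>2 \<ge> 0"
  shows "p * x\<^sup>2 + 2 * q * x * y + r * y\<^sup>2 \<ge> 0"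
proof (cases "p > 0")
  case True
  have "p * (p * x\<^sup>2 + 2 * q * x * y + r * y\<^sup>2) = (p * x + q * y)\<^sup>2 + (p * r - q\<^sup>2) * y\<^sup>2"
    by (simp add: power2_eq_square algebra_simps)
  also have "\<dots> \<ge> 0"
    using disc by simp
  finally show ?thesis
    using True by (simp add: zero_le_mult_iff)
next
  case False
  then have r: "r \<ge> 0"
    using assms by simp
  then have "p * r \<le> 0"
    using False by (simp add: mult_nonpos_nonneg)
  then have "q\<^sup>2 = 0"
    using disc zero_le_power2[of q] by linarith
  then have q: "q = 0" and "p * r \<ge> 0"
    using disc by simp_all
  then have "p = 0"
    using False r assms by (auto simp: zero_le_mult_iff)
  then show ?thesis
    using r q by simp
qed

text \<open>The norm is the larger absolute eigenvalue. The upper bound holds because e^2 I - A^2 is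
  positive semidefinite, the lower bound because an eigenvector for \<open>e\<close> attains
  it.\<close>

lemma operator_norm_sym2:
  fixes A :: "real^2^2"
  assumes sym: "A $ 2 $ 1 = A $ 1 $ 2" and tr: "A$1$1 + A$2$2 = t"
    and det: "A$1$1 * A$2$2 - (A$1$2)\<^sup>2 = - q" and q: "q \<ge> 0"
  shows "operator_norm A = (\<bar>t\<bar> + sqrt (t\<^sup>2 + 4 * q)) / 2"
proof -
  define R where "R = sqrt (t\<^sup>2 + 4 * q)"
  \<comment> \<open>The eigenvalue on the same side of zero as the trace has the larger modulus,
    namely \<open>m\<close>.\<close>
  define e where "e = (if t \<ge> 0 then (t + R) / 2 else (t - R) / 2)"
  define a b d where "a = A$1$1" and "b = A$1$2" and "d = A$2$2"
  define m where "m = (\<bar>t\<bar> + R) / 2"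
  have R2: "R\<^sup>2 = t\<^sup>2 + 4 * q" and R0: "R \<ge> 0"
    using q by (simp_all add: R_def)
  have t: "t = a + d" and qq: "q = b\<^sup>2 - a * d"
    using tr det by (simp_all add: a_def b_def d_def)
  have m0: "m \<ge> 0" and e_abs: "\<bar>e\<bar> = m"
    using R0 by (auto simp: m_def e_def)
  have char: "e\<^sup>2 = t * e + q"
    using R2 by (simp add: e_def power2_eq_square field_simps)
  have e2: "e\<^sup>2 = m\<^sup>2"
    using e_abs by (metis power2_abs)
  have A_vec: "(A *v v) $ 1 = a * v$1 + b * v$2" "(A *v v) $ 2 = b * v$1 + d * v$2" for v
    by (simp_all add: matrix_vector_mult_def sum_2 a_def b_def d_def sym)
  have norm2: "(norm v)\<^sup>2 = (v$1)\<^sup>2 + (v$2)\<^sup>2" for v :: "real^2"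
    by (simp add: norm_vec_def L2_set_def sum_2)
  have upper: "norm (A *v v) \<le> m * norm v" for v
  proof -
    \<comment> \<open>The entries of e^2 I - A^2. Its trace is |t| R >= 0, and its determinant
      vanishes since e^2 is an eigenvalue of A^2.\<close>
    define P Q S where "P = e\<^sup>2 - (a\<^sup>2 + b\<^sup>2)" and "Q = - (b * t)" and "S = e\<^sup>2 - (b\<^sup>2 + d\<^sup>2)"
    have "P + S = 2 * e\<^sup>2 - t\<^sup>2 - 2 * q"
      by (simp add: P_def S_def t qq power2_eq_square algebra_simps)
    moreover have "2 * (t * e) = t\<^sup>2 + \<bar>t\<bar> * R"
      by (simp add: e_def power2_eq_square field_simps)
    ultimately have PS: "P + S \<ge> 0"
      using R0 by (simp add: char)
    have "P * S - Q\<^sup>2 = (e\<^sup>2)\<^sup>2 - e\<^sup>2 * (t\<^sup>2 + 2 * q) + q\<^sup>2"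
      by (simp add: P_def S_def Q_def t qq power2_eq_square algebra_simps)
    also have "\<dots> = (e\<^sup>2 - q)\<^sup>2 - (t * e)\<^sup>2"
      by (simp add: power2_eq_square algebra_simps)
    also have "\<dots> = 0"
      by (simp add: char)
    finally have "P * (v$1)\<^sup>2 + 2 * Q * v$1 * v$2 + S * (v$2)\<^sup>2 \<ge> 0"
      using binary_quadratic_form_nonneg[OF PS] by simp
    then have "(norm (A *v v))\<^sup>2 \<le> (m * norm v)\<^sup>2"
      unfolding power_mult_distrib norm2 A_vec e2[symmetric]
      by (simp add: P_def Q_def S_def t power2_eq_square algebra_simps)
    then show ?thesis
      using m0 by (simp add: power2_le_iff_abs_le)
  qed
  have "\<exists>v::real^2. v \<noteq> 0 \<and> A *v v = e *s v"
  \<comment> \<open>The vector (b, e - a) always solves both rows, the second one by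
    \<open>char\<close>; it is zero exactly in the excluded case, where the first unit vector
    serves.\<close>
  proof (cases "b = 0 \<and> e = a")
    case True
    then show ?thesis
      by (intro exI[of _ "vector [1, 0]"]) (simp add: vec_eq_iff forall_2 A_vec)
  next
    case False
    have "b * b + d * (e - a) = e * (e - a)"
      using char by (simp add: t qq power2_eq_square algebra_simps)
    then show ?thesis
      using False
      by (intro exI[of _ "vector [b, e - a]"])
        (auto simp: vec_eq_iff forall_2 A_vec algebra_simps)
  qed
  then obtain v where v: "v \<noteq> 0" "A *v v = e *s v"
    by blast
  have "onorm ((*v) A) \<le> m"
    using upper by (intro onorm_le) auto
  moreover have "m * norm v \<le> onorm ((*v) A) * norm v"
    using onorm[OF matrix_vector_mul_bounded_linear, of A v] v e_abs
    by (simp add: scalar_mult_eq_scaleR)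
  then have "m \<le> onorm ((*v) A)"
    using v by simp
  ultimately show ?thesis
    by (simp add: operator_norm_def m_def R_def)
qed

text \<open>The loss matrix is diag(l, 0) minus \<theta> times the projection onto the unit vector
  (c, s).\<close>

lemma loss_matrix_sym2:
  assumes "c\<^sup>2 \<le> 1"
  shows "loss_matrix l \<theta> c $ 2 $ 1 = loss_matrix l \<theta> c $ 1 $ 2"
    and "loss_matrix l \<theta> c $ 1 $ 1 + loss_matrix l \<theta> c $ 2 $ 2 = l - \<theta>"
    and "loss_matrix l \<theta> c $ 1 $ 1 * loss_matrix l \<theta> c $ 2 $ 2 - (loss_matrix l \<theta> c $ 1 $ 2)\<^sup>2
      = - (l * \<theta> * (1 - c\<^sup>2))"
  using assms by (simp_all add: loss_matrix_def power_mult_distrib Let_def)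
    (simp_all add: power2_eq_square algebra_simps)

text \<open>The variable \<open>q\<close> stands for minus the determinant, so that each use can
  supply it in simplified form.\<close>

lemma norm_loss_matrix:
  assumes c: "c\<^sup>2 \<le> 1" and "l \<ge> 0" "\<theta> \<ge> 0" and q: "l * \<theta> * (1 - c\<^sup>2) = q"
  shows "frobenius_norm (loss_matrix l \<theta> c) = sqrt ((l - \<theta>)\<^sup>2 + 2 * q)"
    and "operator_norm (loss_matrix l \<theta> c) = (\<bar>l - \<theta>\<bar> + sqrt ((l - \<theta>)\<^sup>2 + 4 * q)) / 2"
    and "nuclear_norm (loss_matrix l \<theta> c) = sqrt ((l - \<theta>)\<^sup>2 + 4 * q)"
proof -
  have "q \<ge> 0"
    using assms by (simp flip: q)
  then show "frobenius_norm (loss_matrix l \<theta> c) = sqrt ((l - \<theta>)\<^sup>2 + 2 * q)"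
    "operator_norm (loss_matrix l \<theta> c) = (\<bar>l - \<theta>\<bar> + sqrt ((l - \<theta>)\<^sup>2 + 4 * q)) / 2"
    "nuclear_norm (loss_matrix l \<theta> c) = sqrt ((l - \<theta>)\<^sup>2 + 4 * q)"
    using loss_matrix_sym2[OF c, of l \<theta>]
    by (simp_all add: q frobenius_norm_sym2 operator_norm_sym2 nuclear_norm_sym2)
qed

section \<open>Admissibility of thresholds\<close>

text \<open>A threshold that dominates all others is itself undominated, since domination is
  irreflexive and asymmetric.\<close>

lemma unique_admissibleI:
  assumes "\<And>\<nu>. \<nu> \<noteq> \<tau> \<Longrightarrow> dominates L lam \<tau> \<nu>"
  shows "unique_admissible L lam \<tau>"
proof -
  have "\<not> dominates L lam \<nu> \<tau>" for \<nu>
    using assms[of \<nu>] by (cases "\<nu> = \<tau>") (force simp: dominates_def)+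
  then show ?thesis
    using assms by (auto simp: unique_admissible_def admissible_threshold_def)
qed

text \<open>Two thresholds act differently only on eigenvalues between them. At
  \<open>lam l = \<tau>\<close> the first two hypotheses force a tie of the losses, so keeping or
  killing that value is indifferent; hence the witnesses lie strictly on one side of \<tau>, whereas
  in \<open>ex_below\<close> the value \<nu> is allowed because its rule keeps it.\<close>

lemma unique_admissible_crossing:
  assumes above: "\<And>l. l \<ge> 0 \<Longrightarrow> L l (lam l) < L l 0 \<longleftrightarrow> \<tau> < lam l"
    and below: "\<And>l. l \<ge> 0 \<Longrightarrow> L l 0 < L l (lam l) \<longleftrightarrow> lam l < \<tau>"
    and ex_below: "\<And>\<nu>. \<nu> < \<tau> \<Longrightarrow> \<exists>l\<ge>0. \<nu> \<le> lam l \<and> lam l < \<tau>"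
    and ex_above: "\<And>\<nu>. \<tau> < \<nu> \<Longrightarrow> \<exists>l\<ge>0. \<tau> < lam l \<and> lam l < \<nu>"
  shows "unique_admissible L lam \<tau>"
proof (rule unique_admissibleI)
  fix \<nu> assume "\<nu> \<noteq> \<tau>"
  have "threshold_loss L lam \<tau> l \<le> threshold_loss L lam \<nu> l" if "l \<ge> 0" for l
    using above[OF that] below[OF that]
    by (auto simp: threshold_loss_def hard_threshold_def)
  moreover have "\<exists>l\<ge>0. threshold_loss L lam \<tau> l < threshold_loss L lam \<nu> l"
  proof (cases "\<nu> < \<tau>")
    case True
    then obtain l where "l \<ge> 0" "\<nu> \<le> lam l" "lam l < \<tau>"
      using ex_below by blast
    then show ?thesis
      using below[of l] by (intro exI[of _ l]) (auto simp: threshold_loss_def hard_threshold_def)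
  next
    case False
    then obtain l where "l \<ge> 0" "\<tau> < lam l" "lam l < \<nu>"
      using ex_above \<open>\<nu> \<noteq> \<tau>\<close> by (meson linorder_neqE)
    then show ?thesis
      using above[of l] by (intro exI[of _ l]) (auto simp: threshold_loss_def hard_threshold_def)
  qed
  ultimately show "dominates L lam \<tau> \<nu>"
    by (simp add: dominates_def)
qed

section \<open>The case of vanishing aspect ratio\<close>

lemma add_inverse_less_iff:
  fixes x y :: real
  assumes "x \<ge> 1" "y \<ge> 1"
  shows "x + 1 / x < y + 1 / y \<longleftrightarrow> x < y"
proof -
  have mono: "u + 1 / u < v + 1 / v" if "1 \<le> u" "u < v" for u v :: real
  proof -
    \<comment> \<open>The factor u v - 1 is what makes the sum increase beyond 1.\<close>
    have "v + 1 / v - (u + 1 / u) = (v - u) * (u * v - 1) / (u * v)"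
      using that by (simp add: field_simps)
    moreover have "1 * 1 < u * v"
      using that by (intro mult_le_less_imp_less) auto
    ultimately show ?thesis
      using that by (smt (verit) divide_pos_pos mult_pos_pos)
  qed
  show ?thesis
    using mono[of x y] mono[of y x] assms by (cases x y rule: linorder_cases) auto
qed

lemma lambda_zero_surj:
  assumes "x > 2"
  obtains l where "l > 1" "lambda_zero l = x"
proof -
  \<comment> \<open>The larger root of l^2 - x l + 1 = 0.\<close>
  define l where "l = (x + sqrt (x\<^sup>2 - 4)) / 2"
  have "(2::real)\<^sup>2 \<le> x\<^sup>2"
    using assms by (intro power_mono) auto
  then have s2: "(sqrt (x\<^sup>2 - 4))\<^sup>2 = x\<^sup>2 - 4" and s0: "sqrt (x\<^sup>2 - 4) \<ge> 0"
    by simp_all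
  have "2 < x + sqrt (x\<^sup>2 - 4)"
    using assms s0 by linarith
  then have l: "l > 1"
    by (simp add: l_def)
  have "l * l + 1 = x * l"
    using s2 by (simp add: l_def power2_eq_square field_simps)
  then have "l + 1 / l = x"
    using l by (simp add: field_simps)
  then show thesis
    using that[of l] l by (simp add: lambda_zero_def)
qed

text \<open>Here \<open>k\<close> is the square of the critical spike, and \<tau> is the empirical
  eigenvalue at that spike. Spikes up to 1 all share the eigenvalue 2 < \<tau>, where
  \<open>small\<close> makes zero the better choice.\<close>

lemma unique_admissible_lambda_zero:
  assumes k: "k > 1" and zero: "\<And>l. l \<ge> 0 \<Longrightarrow> L l 0 = l"
    and small: "\<And>l. 0 \<le> l \<Longrightarrow> l \<le> 1 \<Longrightarrow> l < L l 2"
    and above: "\<And>l. l > 1 \<Longrightarrow> L l (l + 1 / l) < l \<longleftrightarrow> k < l\<^sup>2"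
    and below: "\<And>l. l > 1 \<Longrightarrow> l < L l (l + 1 / l) \<longleftrightarrow> l\<^sup>2 < k"
    and \<tau>: "\<tau> = sqrt k + 1 / sqrt k"
  shows "unique_admissible L lambda_zero \<tau>"
proof -
  have sk: "sqrt k > 1"
    using k by simp
  then have \<tau>2: "\<tau> > 2"
    using add_inverse_less_iff[of 1 "sqrt k"] by (simp add: \<tau>)
  have surj: "\<exists>l\<ge>0. x = lambda_zero l" if "x \<ge> 2" for x
  proof (cases "x = 2")
    case True
    then show ?thesis
      by (auto simp: lambda_zero_def)
  next
    case False
    then have "x > 2"
      using that by simp
    then obtain l where "l > 1" "lambda_zero l = x"
      by (rule lambda_zero_surj)
    then show ?thesis
      by (intro exI[of _ l]) auto
  qed
  have cmp: "\<tau> < lambda_zero l \<longleftrightarrow> k < l\<^sup>2" "lambda_zero l < \<tau> \<longleftrightarrow> l\<^sup>2 < k" if "l > 1" for l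
    using that sk k real_sqrt_less_iff[of k "l\<^sup>2"] real_sqrt_less_iff[of "l\<^sup>2" k]
      add_inverse_less_iff[of "sqrt k" l] add_inverse_less_iff[of l "sqrt k"]
    by (simp_all add: \<tau> lambda_zero_def)
  show ?thesis
  proof (rule unique_admissible_crossing)
    fix l :: real assume l: "l \<ge> 0"
    show "L l (lambda_zero l) < L l 0 \<longleftrightarrow> \<tau> < lambda_zero l"
      using above[of l] small[of l] cmp[of l] \<tau>2 l
      by (cases "l > 1") (auto simp: lambda_zero_def zero)
    show "L l 0 < L l (lambda_zero l) \<longleftrightarrow> lambda_zero l < \<tau>"
      using below[of l] small[of l] cmp[of l] \<tau>2 l
      by (cases "l > 1") (auto simp: lambda_zero_def zero)
  next
    fix \<nu> assume "\<nu> < \<tau>"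
    \<comment> \<open>A threshold below 2 keeps every eigenvalue, so 2 exposes it; any other
      threshold below \<tau> is exposed at its own value.\<close>
    then show "\<exists>l\<ge>0. \<nu> \<le> lambda_zero l \<and> lambda_zero l < \<tau>"
      using surj[of "max 2 \<nu>"] \<tau>2 by auto
  next
    fix \<nu> assume "\<tau> < \<nu>"
    then have "\<tau> < (\<tau> + \<nu>) / 2" "(\<tau> + \<nu>) / 2 < \<nu>"
      by simp_all
    then show "\<exists>l\<ge>0. \<tau> < lambda_zero l \<and> lambda_zero l < \<nu>"
      using surj[of "(\<tau> + \<nu>) / 2"] \<tau>2 by (metis order.strict_trans order.strict_implies_order)
  qed
qed

lemma c_zero_sq: "(c_zero l)\<^sup>2 = (if l > 1 then 1 - 1 / l\<^sup>2 else 0)"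
  using one_le_power[of l 2] by (auto simp: c_zero_def)

text \<open>Here l - \<theta> = -1/l and 1 - c^2 = 1/l^2.\<close>

lemma loss_zero_gt_1:
  assumes l: "l > 1"
  shows "loss_zero frobenius_norm l (l + 1 / l) = sqrt (2 + 3 / l\<^sup>2)"
    and "loss_zero operator_norm l (l + 1 / l) = (1 / l + sqrt (4 + 5 / l\<^sup>2)) / 2"
    and "loss_zero nuclear_norm l (l + 1 / l) = sqrt (4 + 5 / l\<^sup>2)"
proof -
  have c: "(c_zero l)\<^sup>2 \<le> 1"
    using l by (simp add: c_zero_sq)
  have q: "l * (l + 1 / l) * (1 - (c_zero l)\<^sup>2) = 1 + 1 / l\<^sup>2"
    using l by (simp add: c_zero_sq) (simp add: field_simps power2_eq_square)
  have \<theta>: "l + 1 / l \<ge> 0" "l \<ge> 0"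
    using l by simp_all
  show "loss_zero frobenius_norm l (l + 1 / l) = sqrt (2 + 3 / l\<^sup>2)"
    "loss_zero operator_norm l (l + 1 / l) = (1 / l + sqrt (4 + 5 / l\<^sup>2)) / 2"
    "loss_zero nuclear_norm l (l + 1 / l) = sqrt (4 + 5 / l\<^sup>2)"
    using l unfolding loss_zero_def
    by (simp_all add: norm_loss_matrix[OF c \<theta>(2,1) q] power_divide algebra_simps)
qed

text \<open>For these spikes c = 0, so the loss matrix is diag(l, -2).\<close>

lemma loss_zero_le_1:
  assumes "0 \<le> l" "l \<le> 1"
  shows "loss_zero frobenius_norm l 2 = sqrt (l\<^sup>2 + 4)"
    and "loss_zero operator_norm l 2 = 2"
    and "loss_zero nuclear_norm l 2 = l + 2"
proof -
  have c: "(c_zero l)\<^sup>2 = 0" "(c_zero l)\<^sup>2 \<le> 1"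
    using assms by (simp_all add: c_zero_sq)
  have "(l - 2)\<^sup>2 + 2 * (l * 2) = l\<^sup>2 + 4" "(l - 2)\<^sup>2 + 4 * (l * 2) = (l + 2)\<^sup>2"
    by (simp_all add: power2_eq_square algebra_simps)
  then show "loss_zero frobenius_norm l 2 = sqrt (l\<^sup>2 + 4)"
    "loss_zero operator_norm l 2 = 2"
    "loss_zero nuclear_norm l 2 = l + 2"
    using assms unfolding loss_zero_def
    by (simp_all add: norm_loss_matrix[OF c(2) _ _ refl] c(1))
qed

lemma loss_zero_0:
  assumes "l \<ge> 0"
  shows "loss_zero frobenius_norm l 0 = l"
    and "loss_zero operator_norm l 0 = l"
    and "loss_zero nuclear_norm l 0 = l"
proof -
  have c: "(c_zero l)\<^sup>2 \<le> 1"
    by (simp add: c_zero_sq)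
  show "loss_zero frobenius_norm l 0 = l" "loss_zero operator_norm l 0 = l"
    "loss_zero nuclear_norm l 0 = l"
    using assms unfolding loss_zero_def
    by (simp_all add: norm_loss_matrix[OF c _ _ refl])
qed

text \<open>With \<open>x = l\<^sup>2\<close>, comparing the Frobenius and nuclear losses with \<open>l\<close> amounts to the sign of
  \<open>x\<^sup>2 - b x - (b + 1) = (x - (b + 1)) (x + 1)\<close> for \<open>b = 2\<close> and \<open>b = 4\<close>.\<close>

lemma add_divide_compare:
  fixes b x :: real
  assumes "x > 0"
  shows "b + (b + 1) / x < x \<longleftrightarrow> b + 1 < x" and "x < b + (b + 1) / x \<longleftrightarrow> x < b + 1"
proof -
  have "x - (b + (b + 1) / x) = (x - (b + 1)) * ((x + 1) / x)"
    using assms by (simp add: field_simps)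
  moreover have "(x + 1) / x > 0"
    using assms by simp
  ultimately show "b + (b + 1) / x < x \<longleftrightarrow> b + 1 < x" "x < b + (b + 1) / x \<longleftrightarrow> x < b + 1"
    by (metis diff_gt_0_iff_gt zero_less_mult_pos2 mult_pos_pos,
        metis diff_less_0_iff_less mult_less_0_iff order_less_asym)
qed

text \<open>The real \<open>sqrt\<close> is strictly increasing on the whole line, so
  \<open>x\<close> may be negative.\<close>

lemma sqrt_compare:
  assumes "l \<ge> 0"
  shows "sqrt x < l \<longleftrightarrow> x < l\<^sup>2" and "l < sqrt x \<longleftrightarrow> l\<^sup>2 < x"
  using assms real_sqrt_less_iff[of x "l\<^sup>2"] real_sqrt_less_iff[of "l\<^sup>2" x] by simp_all

text \<open>Squaring compares 2 + 3/l^2 with l^2, which cross at l^2 = 3.\<close>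

lemma unique_admissible_frobenius_zero:
  "unique_admissible (loss_zero frobenius_norm) lambda_zero (4 / sqrt 3)"
proof (rule unique_admissible_lambda_zero[where k = 3])
  fix l :: real
  show "l < loss_zero frobenius_norm l 2" if "0 \<le> l" "l \<le> 1"
    using that by (simp add: loss_zero_le_1 real_less_rsqrt)
  show "loss_zero frobenius_norm l (l + 1 / l) < l \<longleftrightarrow> 3 < l\<^sup>2"
    "l < loss_zero frobenius_norm l (l + 1 / l) \<longleftrightarrow> l\<^sup>2 < 3" if "l > 1"
    using that add_divide_compare[of "l\<^sup>2" 2] by (simp_all add: loss_zero_gt_1 sqrt_compare)
qed (simp_all add: loss_zero_0 field_simps)

text \<open>Squaring compares 4 + 5/l^2 with l^2, which cross at l^2 = 5.\<close>

lemma unique_admissible_nuclear_zero: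
  "unique_admissible (loss_zero nuclear_norm) lambda_zero (6 / sqrt 5)"
proof (rule unique_admissible_lambda_zero[where k = 5])
  fix l :: real
  show "l < loss_zero nuclear_norm l 2" if "0 \<le> l" "l \<le> 1"
    using that by (simp add: loss_zero_le_1)
  show "loss_zero nuclear_norm l (l + 1 / l) < l \<longleftrightarrow> 5 < l\<^sup>2"
    "l < loss_zero nuclear_norm l (l + 1 / l) \<longleftrightarrow> l\<^sup>2 < 5" if "l > 1"
    using that add_divide_compare[of "l\<^sup>2" 4] by (simp_all add: loss_zero_gt_1 sqrt_compare)
qed (simp_all add: loss_zero_0 field_simps)

text \<open>Isolating the root and squaring, allowed because 2 l - 1/l >= 0, leaves the comparison
  of (l^2 - 1)^2 with 2; hence the critical value l^2 = 1 + sqrt 2.\<close>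

lemma unique_admissible_operator_zero:
  "unique_admissible (loss_zero operator_norm) lambda_zero (sqrt (2 * (1 + sqrt 2)))"
proof (rule unique_admissible_lambda_zero[where k = "1 + sqrt 2"])
  fix l :: real
  show "l < loss_zero operator_norm l 2" if "0 \<le> l" "l \<le> 1"
    using that by (simp add: loss_zero_le_1)
  assume l: "l > 1"
  then have l2: "l\<^sup>2 > 1"
    by simp
  have inv: "1 / l < l"
    using l l2 by (simp add: field_simps power2_eq_square)
  have pos: "2 * l - 1 / l \<ge> 0"
    using l inv by simp
  have sq: "(2 * l - 1 / l)\<^sup>2 - (4 + 5 / l\<^sup>2) = 4 / l\<^sup>2 * ((l\<^sup>2 - 1)\<^sup>2 - 2)"
    using l by (simp add: field_simps power2_eq_square)
  have sign: "0 < 4 / l\<^sup>2 * z \<longleftrightarrow> 0 < z" "4 / l\<^sup>2 * z < 0 \<longleftrightarrow> z < 0" for z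
    using l by (auto simp: zero_less_mult_iff mult_less_0_iff zero_less_divide_iff divide_less_0_iff)
  show "loss_zero operator_norm l (l + 1 / l) < l \<longleftrightarrow> 1 + sqrt 2 < l\<^sup>2"
  proof -
    have "loss_zero operator_norm l (l + 1 / l) < l \<longleftrightarrow> sqrt (4 + 5 / l\<^sup>2) < 2 * l - 1 / l"
      using l by (auto simp: loss_zero_gt_1)
    also have "\<dots> \<longleftrightarrow> 0 < (2 * l - 1 / l)\<^sup>2 - (4 + 5 / l\<^sup>2)"
      unfolding sqrt_compare(1)[OF pos] by linarith
    also have "\<dots> \<longleftrightarrow> 2 < (l\<^sup>2 - 1)\<^sup>2"
      unfolding sq sign by linarith
    also have "\<dots> \<longleftrightarrow> sqrt 2 < l\<^sup>2 - 1"
      using sqrt_compare(1)[of "l\<^sup>2 - 1" 2] l2 by simp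
    finally show ?thesis
      by auto
  qed
  show "l < loss_zero operator_norm l (l + 1 / l) \<longleftrightarrow> l\<^sup>2 < 1 + sqrt 2"
  proof -
    have "l < loss_zero operator_norm l (l + 1 / l) \<longleftrightarrow> 2 * l - 1 / l < sqrt (4 + 5 / l\<^sup>2)"
      using l by (auto simp: loss_zero_gt_1)
    also have "\<dots> \<longleftrightarrow> (2 * l - 1 / l)\<^sup>2 - (4 + 5 / l\<^sup>2) < 0"
      unfolding sqrt_compare(2)[OF pos] by linarith
    also have "\<dots> \<longleftrightarrow> (l\<^sup>2 - 1)\<^sup>2 < 2"
      unfolding sq sign by linarith
    also have "\<dots> \<longleftrightarrow> l\<^sup>2 - 1 < sqrt 2"
      using sqrt_compare(2)[of "l\<^sup>2 - 1" 2] l2 by simp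
    finally show ?thesis
      by auto
  qed
next
  \<comment> \<open>Since 1/k = sqrt 2 - 1, the square k + 2 + 1/k of the threshold collapses to 2
    k.\<close>
  define k where "k = 1 + sqrt (2::real)"
  have k: "k > 0"
    by (simp add: k_def add_pos_pos)
  have "1 / k = sqrt 2 - 1"
    using k by (simp add: k_def field_simps)
  then have "(sqrt k + 1 / sqrt k)\<^sup>2 = 2 * k"
    using k by (simp add: power2_sum power_divide) (simp add: k_def)
  then have "sqrt (2 * k) = sqrt k + 1 / sqrt k"
    using k by (intro real_sqrt_unique) simp_all
  then show "sqrt (2 * (1 + sqrt 2)) = sqrt (1 + sqrt 2) + 1 / sqrt (1 + sqrt 2)"
    by (simp add: k_def)
qed (simp_all add: loss_zero_0)

section \<open>The case of diverging aspect ratio\<close>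

text \<open>The eigenvalue is affine in the spike, so \<open>k\<close> is now the critical spike
  itself.\<close>

lemma unique_admissible_lambda_infty:
  assumes k: "k > 0" and zero: "\<And>\<rho>. \<rho> \<ge> 0 \<Longrightarrow> L \<rho> 0 = \<rho>"
    and above: "\<And>\<rho>. \<rho> \<ge> 0 \<Longrightarrow> L \<rho> (1 + \<rho>) < \<rho> \<longleftrightarrow> k < \<rho>"
    and below: "\<And>\<rho>. \<rho> \<ge> 0 \<Longrightarrow> \<rho> < L \<rho> (1 + \<rho>) \<longleftrightarrow> \<rho> < k"
    and \<tau>: "\<tau> = 1 + k"
  shows "unique_admissible L lambda_infty \<tau>"
proof (rule unique_admissible_crossing)
  fix \<nu> assume "\<nu> < \<tau>"
  then show "\<exists>\<rho>\<ge>0. \<nu> \<le> lambda_infty \<rho> \<and> lambda_infty \<rho> < \<tau>"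
    using k by (intro exI[of _ "max 0 (\<nu> - 1)"]) (auto simp: \<tau> lambda_infty_def)
next
  fix \<nu> assume "\<tau> < \<nu>"
  \<comment> \<open>The witness is the spike whose eigenvalue is the midpoint of \<tau> and
    \<nu>.\<close>
  then show "\<exists>\<rho>\<ge>0. \<tau> < lambda_infty \<rho> \<and> lambda_infty \<rho> < \<nu>"
    using k by (intro exI[of _ "(\<tau> + \<nu>) / 2 - 1"]) (auto simp: \<tau> lambda_infty_def field_simps)
qed (simp_all add: lambda_infty_def \<tau> zero above below)

lemma c_infty_sq: "\<rho> \<ge> 0 \<Longrightarrow> (c_infty \<rho>)\<^sup>2 = \<rho> / (1 + \<rho>)"
  by (simp add: c_infty_def)

lemma c_infty_sq_le_1: "\<rho> \<ge> 0 \<Longrightarrow> (c_infty \<rho>)\<^sup>2 \<le> 1"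
  by (simp add: c_infty_sq)

text \<open>Here \<rho> - \<theta> = -1 and 1 - c^2 = 1/(1 + \<rho>), so minus the determinant is
  just \<rho>.\<close>

lemma loss_infty_eq:
  assumes "\<rho> \<ge> 0"
  shows "loss_infty frobenius_norm \<rho> (1 + \<rho>) = sqrt (1 + 2 * \<rho>)"
    and "loss_infty operator_norm \<rho> (1 + \<rho>) = (1 + sqrt (1 + 4 * \<rho>)) / 2"
    and "loss_infty nuclear_norm \<rho> (1 + \<rho>) = sqrt (1 + 4 * \<rho>)"
proof -
  note c = c_infty_sq_le_1[OF assms]
  have q: "\<rho> * (1 + \<rho>) * (1 - (c_infty \<rho>)\<^sup>2) = \<rho>"
    using assms by (simp add: c_infty_sq field_simps)
  show "loss_infty frobenius_norm \<rho> (1 + \<rho>) = sqrt (1 + 2 * \<rho>)"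
    "loss_infty operator_norm \<rho> (1 + \<rho>) = (1 + sqrt (1 + 4 * \<rho>)) / 2"
    "loss_infty nuclear_norm \<rho> (1 + \<rho>) = sqrt (1 + 4 * \<rho>)"
    using assms unfolding loss_infty_def by (simp_all add: norm_loss_matrix[OF c _ _ q])
qed

lemma loss_infty_0:
  assumes "\<rho> \<ge> 0"
  shows "loss_infty frobenius_norm \<rho> 0 = \<rho>"
    and "loss_infty operator_norm \<rho> 0 = \<rho>"
    and "loss_infty nuclear_norm \<rho> 0 = \<rho>"
proof -
  note c = c_infty_sq_le_1[OF assms]
  show "loss_infty frobenius_norm \<rho> 0 = \<rho>" "loss_infty operator_norm \<rho> 0 = \<rho>"
    "loss_infty nuclear_norm \<rho> 0 = \<rho>"
    using assms unfolding loss_infty_def by (simp_all add: norm_loss_matrix[OF c _ _ refl])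
qed

text \<open>The number \<open>b + sqrt (b\<^sup>2 + 1)\<close> is the positive root of \<open>\<rho>\<^sup>2 = 1 + 2 b \<rho>\<close>.\<close>

lemma sqrt_linear_compare:
  fixes b \<rho> :: real
  assumes "\<rho> \<ge> 0"
  shows "sqrt (1 + 2 * b * \<rho>) < \<rho> \<longleftrightarrow> b + sqrt (b\<^sup>2 + 1) < \<rho>"
    and "\<rho> < sqrt (1 + 2 * b * \<rho>) \<longleftrightarrow> \<rho> < b + sqrt (b\<^sup>2 + 1)"
proof -
  define S where "S = sqrt (b\<^sup>2 + 1)"
  have S2: "S\<^sup>2 = b\<^sup>2 + 1"
    by (simp add: S_def)
  have Sb: "S > b"
    unfolding S_def by (rule real_less_rsqrt) simp
  \<comment> \<open>The second factor belongs to the negative root b - S and stays positive, so the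
    first one decides the sign.\<close>
  have "\<rho>\<^sup>2 - (1 + 2 * b * \<rho>) = (\<rho> - (b + S)) * (\<rho> - b + S)"
    using S2 by (simp add: power2_eq_square algebra_simps)
  moreover have "\<rho> - b + S > 0"
    using Sb assms by simp
  ultimately have *: "1 + 2 * b * \<rho> < \<rho>\<^sup>2 \<longleftrightarrow> b + S < \<rho>" "\<rho>\<^sup>2 < 1 + 2 * b * \<rho> \<longleftrightarrow> \<rho> < b + S"
    by (smt (verit) mult_pos_pos mult_neg_pos mult_eq_0_iff)+
  show "sqrt (1 + 2 * b * \<rho>) < \<rho> \<longleftrightarrow> b + sqrt (b\<^sup>2 + 1) < \<rho>"
    "\<rho> < sqrt (1 + 2 * b * \<rho>) \<longleftrightarrow> \<rho> < b + sqrt (b\<^sup>2 + 1)"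
    using * assms by (simp_all only: S_def sqrt_compare)
qed

text \<open>The case b = 1 of \<open>sqrt_linear_compare\<close>.\<close>

lemma unique_admissible_frobenius_infty:
  "unique_admissible (loss_infty frobenius_norm) lambda_infty (2 + sqrt 2)"
proof (rule unique_admissible_lambda_infty[where k = "1 + sqrt 2"])
  fix \<rho> :: real assume "\<rho> \<ge> 0"
  then show "loss_infty frobenius_norm \<rho> (1 + \<rho>) < \<rho> \<longleftrightarrow> 1 + sqrt 2 < \<rho>"
    "\<rho> < loss_infty frobenius_norm \<rho> (1 + \<rho>) \<longleftrightarrow> \<rho> < 1 + sqrt 2"
    using sqrt_linear_compare[of \<rho> 1] by (simp_all add: loss_infty_eq)
qed (simp_all add: loss_infty_0 add_pos_pos)

text \<open>The case b = 2 of \<open>sqrt_linear_compare\<close>.\<close>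

lemma unique_admissible_nuclear_infty:
  "unique_admissible (loss_infty nuclear_norm) lambda_infty (3 + sqrt 5)"
proof (rule unique_admissible_lambda_infty[where k = "2 + sqrt 5"])
  fix \<rho> :: real assume "\<rho> \<ge> 0"
  then show "loss_infty nuclear_norm \<rho> (1 + \<rho>) < \<rho> \<longleftrightarrow> 2 + sqrt 5 < \<rho>"
    "\<rho> < loss_infty nuclear_norm \<rho> (1 + \<rho>) \<longleftrightarrow> \<rho> < 2 + sqrt 5"
    using sqrt_linear_compare[of \<rho> 2] by (simp_all add: loss_infty_eq)
qed (simp_all add: loss_infty_0 add_pos_pos)

lemma unique_admissible_operator_infty:
  "unique_admissible (loss_infty operator_norm) lambda_infty 3"
proof (rule unique_admissible_lambda_infty[where k = 2])
  fix \<rho> :: real assume \<rho>: "\<rho> \<ge> 0"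
  \<comment> \<open>In terms of \<open>y\<close> the spike is (y^2 - 1)/4, and its difference from
    the loss factors with the sign of y - 3; y = 3 means \<rho> = 2.\<close>
  define y where "y = sqrt (1 + 4 * \<rho>)"
  have "y\<^sup>2 = 1 + 4 * \<rho>" and y0: "y \<ge> 0"
    using \<rho> by (simp_all add: y_def)
  then have "\<rho> - (1 + y) / 2 = (y + 1) / 4 * (y - 3)"
    by (simp add: power2_eq_square field_simps)
  moreover have "(y + 1) / 4 > 0"
    using y0 by simp
  ultimately have *: "(1 + y) / 2 < \<rho> \<longleftrightarrow> 3 < y" "\<rho> < (1 + y) / 2 \<longleftrightarrow> y < 3"
    by (smt (verit) mult_pos_pos mult_pos_neg mult_eq_0_iff)+
  have "3 < y \<longleftrightarrow> 2 < \<rho>" "y < 3 \<longleftrightarrow> \<rho> < 2"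
    using sqrt_compare[of 3 "1 + 4 * \<rho>"] by (auto simp: y_def)
  then show "loss_infty operator_norm \<rho> (1 + \<rho>) < \<rho> \<longleftrightarrow> 2 < \<rho>"
    "\<rho> < loss_infty operator_norm \<rho> (1 + \<rho>) \<longleftrightarrow> \<rho> < 2"
    using * \<rho> by (simp_all add: loss_infty_eq y_def)
qed (simp_all add: loss_infty_0)

theorem theorem5p1:
  shows "(unique_admissible (loss_zero frobenius_norm) lambda_zero (4 / sqrt 3)
        \<and> unique_admissible (loss_zero operator_norm) lambda_zero (sqrt (2 * (1 + sqrt 2)))
        \<and> unique_admissible (loss_zero nuclear_norm) lambda_zero (6 / sqrt 5))
       \<and> (unique_admissible (loss_infty frobenius_norm) lambda_infty (2 + sqrt 2)
        \<and> unique_admissible (loss_infty operator_norm) lambda_infty 3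
        \<and> unique_admissible (loss_infty nuclear_norm) lambda_infty (3 + sqrt 5))"
  by (intro conjI unique_admissible_frobenius_zero unique_admissible_operator_zero
      unique_admissible_nuclear_zero unique_admissible_frobenius_infty
      unique_admissible_operator_infty unique_admissible_nuclear_infty)

end
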